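(* For the Thue--Morse word $\mathbf{tm}$ and all $\ell > 0$, $$\rho_{\mathbf{tm}, \ell}^{(S_2, S_{\ell})} = \begin{cases} 1 & \text{if } \ell \text{ is odd}\\ 2 & \text{if } \ell \text{ is even,}\end{cases}$$ where $S_2$ acts by permuting (exchanging) the letters of the alphabet $\{0,1\}$ and $S_\ell$ acts by permuting the $\ell$ positions.
   Context: The Thue--Morse word $\mathbf{tm}\in\{0,1\}^\omega$ is the infinite fixed point, beginning with $0$, of the morphism $0 \mapsto 01$, $1 \mapsto 10$. A factor of an infinite word is a finite contiguous subsequence. Let $G$ be a group acting on an alphabet $\Sigma$, hence letterwise on words, and let $H_\ell$ be a group acting on $\Sigma^\ell$ by permuting positions; then $G \times H_\ell$ acts on $\Sigma^\ell$ by $(g,h)\cdot w = g\cdot(h\cdot w) = h\cdot(g\cdot w)$. For an infinite word $w$ over $\Sigma$, $\rho_{w,\ell}^{(G,H_\ell)}$ denotes the number of equivalence classes in the set of length-$\ell$ factors of $w$, where two factors are equivalent if they lie in the same $G\times H_\ell$-orbit in $\Sigma^\ell$. *)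

theory Defs
  imports "HOL-Algebra.Group_Action" "HOL-Library.Omega_Words_Fun"
begin

section \<open>The Thue--Morse word\<close>

text \<open>
  A morphism of words is given by the images of the letters.  Every image is assumed nonempty, so
  the first \<open>n + 1\<close> letters of \<open>w\<close> already determine the letter at position \<open>n\<close> of the image.
\<close>

definition morphism_word :: "('a \<Rightarrow> 'b list) \<Rightarrow> 'a word \<Rightarrow> 'b word" where
  "morphism_word \<mu> w = (\<lambda>n. concat (map \<mu> (prefix (Suc n) w)) ! n)"

text \<open>Only the values at the letters 0 and 1 matter.\<close>

definition tm_morphism :: "nat \<Rightarrow> nat list" where
  "tm_morphism a = (if a = 0 then [0, 1] else [1, 0])"

definition is_thue_morse :: "nat word \<Rightarrow> bool" where
  "is_thue_morse w \<longleftrightarrow> range w \<subseteq> {0, 1} \<and> w 0 = 0 \<and> morphism_word tm_morphism w = w"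

definition tm :: "nat word" where
  "tm = (THE w. is_thue_morse w)"

lemma tm_morphism_concat:
  shows "length (concat (map tm_morphism u)) = 2 * length u"
    and "n < 2 * length u \<Longrightarrow>
           concat (map tm_morphism u) ! n = tm_morphism (u ! (n div 2)) ! (n mod 2)"
proof (induction u arbitrary: n)
  case (Cons a u)
  { case 1 show ?case using Cons.IH(1) by (simp add: tm_morphism_def) }
  { case 2
    have len: "length (tm_morphism a) = 2" by (simp add: tm_morphism_def)
    show ?case
    proof (cases "n < 2")
      case True
      then show ?thesis by (simp add: nth_append len)
    next
      case False
      then obtain m where m: "n = m + 2" by (metis add.commute le_Suc_ex not_less)
      with 2 have "m < 2 * length u" by simp
      from Cons.IH(2)[OF this] show ?thesis by (simp add: m nth_append len)
    qed }
qed simp_all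

lemma morphism_word_tm_morphism:
  "morphism_word tm_morphism w n = tm_morphism (w (n div 2)) ! (n mod 2)"
proof -
  have "n div 2 < Suc n" by simp
  then have "prefix (Suc n) w ! (n div 2) = w (n div 2)" by (metis add_0 diff_zero subsequence_nth)
  then show ?thesis
    unfolding morphism_word_def
    by (subst tm_morphism_concat(2)) simp_all
qed

fun tm_rec :: "nat \<Rightarrow> nat" where
  "tm_rec n = (if n = 0 then 0 else tm_morphism (tm_rec (n div 2)) ! (n mod 2))"

declare tm_rec.simps [simp del]

lemma is_thue_morse_tm_rec: "is_thue_morse tm_rec"
proof -
  have "tm_rec n \<in> {0, 1}" for n
    using tm_rec.simps[of n] by (auto simp: tm_morphism_def mod2_eq_if split: if_splits)
  moreover have "morphism_word tm_morphism tm_rec n = tm_rec n" for n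
    by (cases "n = 0") (simp_all add: morphism_word_tm_morphism tm_rec.simps[of 0]
          tm_rec.simps[of n] tm_morphism_def)
  ultimately show ?thesis
    unfolding is_thue_morse_def by (intro conjI ext image_subsetI) (simp_all add: tm_rec.simps[of 0])
qed

lemma is_thue_morse_unique:
  assumes "is_thue_morse v" "is_thue_morse w"
  shows "v = w"
proof
  fix n show "v n = w n"
  proof (induction n rule: less_induct)
    case (less n)
    show ?case
    proof (cases "n = 0")
      case True
      then show ?thesis using assms by (simp add: is_thue_morse_def)
    next
      case False
      then have "v (n div 2) = w (n div 2)" using less by simp
      then show ?thesis
        using assms by (metis is_thue_morse_def morphism_word_tm_morphism)
    qed
  qed
qed

lemma is_thue_morse_tm: "is_thue_morse tm"
  unfolding tm_def
  by (rule theI[where a = tm_rec]) (rule is_thue_morse_tm_rec, erule is_thue_morse_unique[OF _ is_thue_morse_tm_rec])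

section \<open>Group actions on finite words and the induced factor complexity\<close>

definition words :: "'a set \<Rightarrow> nat \<Rightarrow> 'a list set" where
  "words A l = {u. set u \<subseteq> A \<and> length u = l}"

definition factors :: "'a word \<Rightarrow> nat \<Rightarrow> 'a list set" where
  "factors w l = {w [i \<rightarrow> i + l] | i. True}"

definition letter_action :: "'a set \<Rightarrow> nat \<Rightarrow> ('g \<Rightarrow> 'a \<Rightarrow> 'a) \<Rightarrow> 'g \<Rightarrow> 'a list \<Rightarrow> 'a list" where
  "letter_action A l \<alpha> g = (\<lambda>u \<in> words A l. map (\<alpha> g) u)"

text \<open>
  The positions are \<open>0, \<dots>, l - 1\<close>.  The element \<open>h\<close> moves the letter at position \<open>i\<close> to position
  \<open>\<beta> h i\<close>; hence the inverse in the formula, which makes this a left action.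
\<close>

definition position_action ::
    "'a set \<Rightarrow> nat \<Rightarrow> 'h monoid \<Rightarrow> ('h \<Rightarrow> nat \<Rightarrow> nat) \<Rightarrow> 'h \<Rightarrow> 'a list \<Rightarrow> 'a list" where
  "position_action A l H \<beta> h = (\<lambda>u \<in> words A l. map (\<lambda>i. u ! \<beta> (inv\<^bsub>H\<^esub> h) i) [0..<l])"

definition word_action ::
    "'a set \<Rightarrow> nat \<Rightarrow> ('g \<Rightarrow> 'a \<Rightarrow> 'a) \<Rightarrow> 'h monoid \<Rightarrow> ('h \<Rightarrow> nat \<Rightarrow> nat) \<Rightarrow>
     'g \<times> 'h \<Rightarrow> 'a list \<Rightarrow> 'a list" where
  "word_action A l \<alpha> H \<beta> =
     (\<lambda>(g, h). \<lambda>u \<in> words A l. letter_action A l \<alpha> g (position_action A l H \<beta> h u))"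

definition factor_equiv ::
    "'a set \<Rightarrow> 'g monoid \<Rightarrow> ('g \<Rightarrow> 'a \<Rightarrow> 'a) \<Rightarrow> 'h monoid \<Rightarrow> ('h \<Rightarrow> nat \<Rightarrow> nat) \<Rightarrow>
     'a word \<Rightarrow> nat \<Rightarrow> 'a list rel" where
  "factor_equiv A G \<alpha> H \<beta> w l =
     {(u, v) \<in> factors w l \<times> factors w l. v \<in> orbit (G \<times>\<times> H) (word_action A l \<alpha> H \<beta>) u}"

text \<open>
  Here \<open>\<alpha>\<close> is the action of \<open>G\<close> on the alphabet \<open>A\<close>, and \<open>\<beta>\<close> the action of \<open>H\<close> (the group
  \<open>H\<^sub>l\<close>, chosen for this \<open>l\<close>) on the positions.
\<close>

definition group_complexity ::
    "'a set \<Rightarrow> 'g monoid \<Rightarrow> ('g \<Rightarrow> 'a \<Rightarrow> 'a) \<Rightarrow> 'h monoid \<Rightarrow> ('h \<Rightarrow> nat \<Rightarrow> nat) \<Rightarrow>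
     'a word \<Rightarrow> nat \<Rightarrow> nat" where
  "group_complexity A G \<alpha> H \<beta> w l = card (factors w l // factor_equiv A G \<alpha> H \<beta> w l)"

lemma factors_subset_words: "range w \<subseteq> A \<Longrightarrow> factors w l \<subseteq> words A l"
  by (auto simp: factors_def words_def image_subset_iff)

lemma group_actionI:
  assumes "group G"
    and ext: "\<And>g. g \<in> carrier G \<Longrightarrow> \<phi> g \<in> extensional E"
    and clo: "\<And>g x. g \<in> carrier G \<Longrightarrow> x \<in> E \<Longrightarrow> \<phi> g x \<in> E"
    and one: "\<And>x. x \<in> E \<Longrightarrow> \<phi> \<one>\<^bsub>G\<^esub> x = x"
    and mul: "\<And>g h x. g \<in> carrier G \<Longrightarrow> h \<in> carrier G \<Longrightarrow> x \<in> E \<Longrightarrow>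
                 \<phi> (g \<otimes>\<^bsub>G\<^esub> h) x = \<phi> g (\<phi> h x)"
  shows "group_action G E \<phi>"
proof -
  interpret group G by fact
  have bij: "\<phi> g \<in> Bij E" if g: "g \<in> carrier G" for g
  proof -
    have "bij_betw (\<phi> g) E E"
      by (rule bij_betw_byWitness[where f' = "\<phi> (inv\<^bsub>G\<^esub> g)"])
        (use g clo in \<open>auto simp: mul[symmetric] one\<close>)
    with ext[OF g] show ?thesis by (simp add: Bij_def)
  qed
  have "\<phi> (g \<otimes>\<^bsub>G\<^esub> h) = compose E (\<phi> g) (\<phi> h)" if "g \<in> carrier G" "h \<in> carrier G" for g h
    using that by (intro extensionalityI[of _ E]) (auto simp: ext mul compose_def)
  with bij have "\<phi> \<in> hom G (BijGroup E)"
    by (auto simp: hom_def BijGroup_def)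
  then show ?thesis
    by (simp add: group_action_def group_hom_def group_hom_axioms_def group_BijGroup is_group)
qed

lemma group_action_BijGroup: "group_action (BijGroup S) S (\<lambda>p. p)"
  by (simp add: group_action_def group_hom_def group_hom_axioms_def group_BijGroup hom_def)

lemma group_action_letter_action:
  assumes "group_action G A \<alpha>"
  shows "group_action G (words A l) (letter_action A l \<alpha>)"
proof -
  interpret group_action G A \<alpha> by fact
  have clo: "map (\<alpha> g) u \<in> words A l" if "g \<in> carrier G" "u \<in> words A l" for g u
    using that element_image by (fastforce simp: words_def)
  show ?thesis
  proof (rule group_actionI)
    show "group G" using group_hom group_hom.axioms(1) by blast
    show "letter_action A l \<alpha> \<one>\<^bsub>G\<^esub> u = u" if "u \<in> words A l" for u
      using that by (auto simp: letter_action_def words_def id_eq_one[symmetric] intro!: map_idI)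
    show "letter_action A l \<alpha> (g \<otimes>\<^bsub>G\<^esub> h) u = letter_action A l \<alpha> g (letter_action A l \<alpha> h u)"
      if "g \<in> carrier G" "h \<in> carrier G" "u \<in> words A l" for g h u
      using that clo[of h u] composition_rule by (auto simp: letter_action_def words_def)
  qed (use clo in \<open>auto simp: letter_action_def\<close>)
qed

lemma group_action_position_action:
  assumes "group_action H {..<l} \<beta>"
  shows "group_action H (words A l) (position_action A l H \<beta>)"
proof -
  interpret group_action H "{..<l}" \<beta> by fact
  interpret H: group H using group_hom group_hom.axioms(1) by blast
  have lt: "\<beta> h i < l" if "h \<in> carrier H" "i < l" for h i
    using that element_image[of h i] by auto
  have clo: "map (\<lambda>i. u ! \<beta> (inv\<^bsub>H\<^esub> h) i) [0..<l] \<in> words A l"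
    if "h \<in> carrier H" "u \<in> words A l" for h u
    using that lt[of "inv\<^bsub>H\<^esub> h"] by (auto simp: words_def)
  show ?thesis
  proof (rule group_actionI)
    show "position_action A l H \<beta> \<one>\<^bsub>H\<^esub> u = u" if "u \<in> words A l" for u
      using that
      by (auto simp: position_action_def words_def id_eq_one[symmetric] intro!: nth_equalityI)
    show "position_action A l H \<beta> (g \<otimes>\<^bsub>H\<^esub> h) u
            = position_action A l H \<beta> g (position_action A l H \<beta> h u)"
      if "g \<in> carrier H" "h \<in> carrier H" "u \<in> words A l" for g h u
      using that clo[of h u]
      by (auto simp: position_action_def H.inv_mult_group composition_rule lt)
  qed (use clo in \<open>auto simp: position_action_def H.is_group\<close>)
qed

lemma letter_position_commute:
  assumes "group_action G A \<alpha>" "group_action H {..<l} \<beta>"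
    and "g \<in> carrier G" "h \<in> carrier H" "u \<in> words A l"
  shows "letter_action A l \<alpha> g (position_action A l H \<beta> h u)
           = position_action A l H \<beta> h (letter_action A l \<alpha> g u)"
proof -
  interpret H: group H
    using assms(2) group_action.group_hom group_hom.axioms(1) by blast
  have "\<beta> (inv\<^bsub>H\<^esub> h) i < l" if "i < l" for i
    using that group_action.element_image[OF assms(2), of "inv\<^bsub>H\<^esub> h" i] assms(4) by auto
  moreover have "position_action A l H \<beta> h u \<in> words A l"
    using group_action.element_image[OF group_action_position_action[OF assms(2)]] assms by blast
  moreover have "letter_action A l \<alpha> g u \<in> words A l"
    using group_action.element_image[OF group_action_letter_action[OF assms(1)]] assms by blast
  ultimately show ?thesis
    using assms(5) by (auto simp: letter_action_def position_action_def words_def)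
qed

lemma group_action_word_action:
  assumes G: "group_action G A \<alpha>" and H: "group_action H {..<l} \<beta>"
  shows "group_action (G \<times>\<times> H) (words A l) (word_action A l \<alpha> H \<beta>)"
proof -
  interpret L: group_action G "words A l" "letter_action A l \<alpha>"
    by (rule group_action_letter_action[OF G])
  interpret P: group_action H "words A l" "position_action A l H \<beta>"
    by (rule group_action_position_action[OF H])
  have clo: "letter_action A l \<alpha> g u \<in> words A l" "position_action A l H \<beta> h u \<in> words A l"
    if "g \<in> carrier G" "h \<in> carrier H" "u \<in> words A l" for g h u
    using that L.element_image P.element_image by blast+
  have "group G" "group H"
    using L.group_hom P.group_hom group_hom.axioms(1) by blast+
  show ?thesis
  proof (rule group_actionI)
    show "group (G \<times>\<times> H)" by (rule DirProd_group) fact+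
    show "word_action A l \<alpha> H \<beta> \<one>\<^bsub>G \<times>\<times> H\<^esub> u = u" if "u \<in> words A l" for u
      using that by (simp add: word_action_def L.id_eq_one[symmetric] P.id_eq_one[symmetric])
    show "word_action A l \<alpha> H \<beta> (x \<otimes>\<^bsub>G \<times>\<times> H\<^esub> y) u
            = word_action A l \<alpha> H \<beta> x (word_action A l \<alpha> H \<beta> y u)"
      if "x \<in> carrier (G \<times>\<times> H)" "y \<in> carrier (G \<times>\<times> H)" "u \<in> words A l" for x y u
      using that
      by (auto simp: word_action_def clo L.composition_rule P.composition_rule
            letter_position_commute[OF G H])
  qed (auto simp: word_action_def clo)
qed

lemma equiv_factor_equiv:
  assumes "group_action G A \<alpha>" "group_action H {..<l} \<beta>" "range w \<subseteq> A"
  shows "equiv (factors w l) (factor_equiv A G \<alpha> H \<beta> w l)"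
proof -
  interpret group_action "G \<times>\<times> H" "words A l" "word_action A l \<alpha> H \<beta>"
    by (rule group_action_word_action) fact+
  note sub = subsetD[OF factors_subset_words[OF assms(3)]]
  show ?thesis
    by (rule equivI)
      (auto simp: factor_equiv_def refl_on_def intro!: symI transI
         intro: orbit_refl orbit_sym orbit_trans sub)
qed

end

theory Submission
  imports Defs "HOL-Combinatorics.Permutations"
begin

text \<open>
  All positions may be permuted, so only the multiset of letters of a factor matters, up to
  renaming letters (\<open>orbit_word_action_BijGroup\<close>).  For a binary word of given length this multiset
  is determined by the balance, the number of ones minus the number of zeros, and exchanging the
  letters negates it.  Hence two binary words of the same length are equivalent exactly if their
  balances agree in absolute value (\<open>binary_orbit_iff\<close>), and the complexity is the number of
  absolute balances that occur among the factors (\<open>binary_group_complexity\<close>).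

  The Thue--Morse word is a concatenation of the blocks \<open>01\<close> and \<open>10\<close>, each of balance 0.  The
  balance of a factor therefore comes only from the blocks that its two ends cut in half.  A factor
  of odd length cuts exactly one block, so its absolute balance is 1.  A factor of even length
  \<open>2 * m\<close> either cuts no block, and has balance 0, or takes the second half of block \<open>a\<close> and the
  first half of block \<open>a + m\<close>.  In the second case the balance is 0 if \<open>tm (a + m) = tm a\<close>;
  otherwise the two halves are the same letter and the absolute balance is 2.  An \<open>a\<close> with
  \<open>tm (a + m) \<noteq> tm a\<close> exists because the Thue--Morse word is not purely periodic
  (\<open>tm_not_periodic\<close>).
\<close>

section \<open>Orbits under all permutations of positions\<close>

lemma mset_map_nth_bij:
  assumes "bij_betw q {..<length u} {..<length u}"
  shows "mset (map (\<lambda>i. u ! q i) [0..<length u]) = mset u"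
proof -
  have "image_mset q (mset_set {..<length u}) = mset_set {..<length u}"
    using assms by (metis bij_betw_def image_mset_mset_set)
  then have "image_mset ((!) u) (image_mset q (mset_set {..<length u}))
      = image_mset ((!) u) (mset_set {..<length u})"
    by simp
  moreover have "image_mset ((!) u) (mset_set {..<length u}) = mset u"
    by (metis atLeast_upt map_nth mset_map mset_set_set distinct_upt)
  ultimately show ?thesis
    by (simp add: multiset.map_comp comp_def lessThan_atLeast0)
qed

lemma carrier_BijGroup: "p \<in> carrier (BijGroup S) \<longleftrightarrow> p \<in> extensional S \<and> bij_betw p S S"
  by (simp add: BijGroup_def Bij_def)

text \<open>
  Two words are rearrangements of each other exactly if they have the same multiset of letters;
  what remains of the product action is then the action of \<open>G\<close> on multisets of letters.
\<close>

lemma orbit_word_action_BijGroup: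
  assumes u: "u \<in> words A l"
  shows "orbit (G \<times>\<times> BijGroup {..<l}) (word_action A l \<alpha> (BijGroup {..<l}) (\<lambda>p. p)) u
           = {v. \<exists>g \<in> carrier G. mset v = image_mset (\<alpha> g) (mset u)}"
    (is "?O = ?M")
proof -
  let ?S = "BijGroup {..<l}"
  interpret S: group ?S by (rule group_BijGroup)
  note pos = group_action.element_image[OF group_action_position_action[OF group_action_BijGroup]]
  have len: "length u = l" using u by (simp add: words_def)
  have act_eq: "word_action A l \<alpha> ?S (\<lambda>p. p) (g, h) u
      = map (\<alpha> g) (map (\<lambda>i. u ! (inv\<^bsub>?S\<^esub> h) i) [0..<l])"
    if h: "h \<in> carrier ?S" for g h
  proof -
    have "position_action A l ?S (\<lambda>p. p) h u \<in> words A l"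
      using pos[OF h u] by blast
    with u show ?thesis
      by (simp add: word_action_def letter_action_def position_action_def)
  qed
  show ?thesis
  proof (intro equalityI subsetI)
    fix v assume "v \<in> ?O"
    then obtain g h where gh: "g \<in> carrier G" "h \<in> carrier ?S"
      and "v = word_action A l \<alpha> ?S (\<lambda>p. p) (g, h) u"
      by (auto simp: orbit_def)
    then have v: "v = map (\<alpha> g) (map (\<lambda>i. u ! (inv\<^bsub>?S\<^esub> h) i) [0..<l])"
      by (simp only: act_eq)
    have "inv\<^bsub>?S\<^esub> h \<in> carrier ?S" using gh by simp
    then have "bij_betw (inv\<^bsub>?S\<^esub> h) {..<length u} {..<length u}"
      by (simp only: carrier_BijGroup len)
    from mset_map_nth_bij[OF this]
    have "mset v = image_mset (\<alpha> g) (mset u)"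
      unfolding v len mset_map[of "\<alpha> g"] by (simp only:)
    with gh(1) show "v \<in> ?M" by blast
  next
    fix v assume "v \<in> ?M"
    then obtain g where g: "g \<in> carrier G" and "mset v = mset (map (\<alpha> g) u)" by auto
    then obtain f where f: "f permutes {..<l}" and v: "permute_list f (map (\<alpha> g) u) = v"
      using len by (metis mset_eq_permutation length_map)
    define q where "q = restrict f {..<l}"
    have q_eq: "q i = f i" if "i < l" for i
      using that by (simp add: q_def)
    then have "bij_betw q {..<l} {..<l} \<longleftrightarrow> bij_betw f {..<l} {..<l}"
      by (intro bij_betw_cong) simp
    then have q: "q \<in> carrier ?S"
      using permutes_imp_bij[OF f] unfolding carrier_BijGroup q_def by blast
    have f_less: "f i < l" if "i < l" for i
      using permutes_in_image[OF f] that by blast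
    have "map (\<lambda>i. map (\<alpha> g) u ! f i) [0..<l] = map (\<lambda>i. \<alpha> g (u ! q i)) [0..<l]"
      by (rule map_cong) (simp_all add: len f_less q_eq)
    then have "v = map (\<alpha> g) (map (\<lambda>i. u ! q i) [0..<l])"
      unfolding v[symmetric] by (simp add: permute_list_def len comp_def)
    \<comment> \<open>The position action reads a word through the inverse permutation, so \<open>q\<close> itself is
      realised by its inverse.\<close>
    also have "\<dots> = word_action A l \<alpha> ?S (\<lambda>p. p) (g, inv\<^bsub>?S\<^esub> q) u"
      using q by (simp only: act_eq S.inv_closed S.inv_inv)
    finally show "v \<in> ?O"
      using g q unfolding orbit_def by (auto intro!: exI[of _ "(g, inv\<^bsub>?S\<^esub> q)"])
  qed
qed

section \<open>The orbit invariant of binary words\<close>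

text \<open>For a binary word, this is the number of ones minus the number of zeros.\<close>

definition balance :: "nat list \<Rightarrow> int" where
  "balance u = (\<Sum>a\<leftarrow>u. 2 * int a - 1)"

lemma balance_eq_mset: "balance u = (\<Sum>a\<in>#mset u. 2 * int a - 1)"
  by (simp add: balance_def flip: sum_mset_sum_list)

lemma balance_map_swap:
  assumes "set u \<subseteq> {0, 1}" "p 0 = 1" "p 1 = 0"
  shows "balance (map p u) = - balance u"
  using assms(1) by (induction u) (auto simp: balance_def assms(2,3)[simplified])

lemma count_of_balance:
  assumes "u \<in> words {0, 1} l"
  shows "2 * int (count (mset u) 0) = int l - balance u"
    and "2 * int (count (mset u) 1) = int l + balance u"
proof -
  have "set u \<subseteq> {0, 1} \<Longrightarrow> 2 * int (count (mset u) 0) = int (length u) - balance u \<and>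
      2 * int (count (mset u) 1) = int (length u) + balance u"
    by (induction u) (auto simp: balance_def)
  with assms show "2 * int (count (mset u) 0) = int l - balance u"
    and "2 * int (count (mset u) 1) = int l + balance u"
    by (auto simp: words_def)
qed

text \<open>
  Length and balance are the sum and the difference of the two letter counts, so together they
  determine both counts.
\<close>

lemma mset_eq_iff_balance_eq:
  assumes u: "u \<in> words {0, 1} l" and v: "v \<in> words {0, 1} l"
  shows "mset u = mset v \<longleftrightarrow> balance u = balance v"
proof
  assume "balance u = balance v"
  show "mset u = mset v"
  proof (rule multiset_eqI)
    fix a
    show "count (mset u) a = count (mset v) a"
    proof (cases "a \<in> {0, 1}")
      case True
      then show ?thesis
        using count_of_balance[OF u] count_of_balance[OF v] \<open>balance u = balance v\<close> by auto
    next
      case False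
      then have "a \<notin> set u" "a \<notin> set v" using u v by (auto simp: words_def)
      then show ?thesis by (metis count_eq_zero_iff set_mset_mset)
    qed
  qed
qed (simp add: balance_eq_mset)

text \<open>
  The alphabet has only two permutations: the identity keeps the balance and the exchange of the
  letters negates it.
\<close>

lemma binary_orbit_iff:
  assumes u: "u \<in> words {0, 1} l" and v: "v \<in> words {0, 1} l"
  shows "v \<in> orbit (BijGroup {0, 1} \<times>\<times> BijGroup {..<l})
                 (word_action {0, 1} l (\<lambda>p. p) (BijGroup {..<l}) (\<lambda>p. p)) u
           \<longleftrightarrow> \<bar>balance v\<bar> = \<bar>balance u\<bar>"
    (is "?L \<longleftrightarrow> ?R")
proof -
  have set_u: "set u \<subseteq> {0, 1}" using u by (simp add: words_def)
  have orbit: "?L \<longleftrightarrow> (\<exists>p \<in> carrier (BijGroup {0, 1}). mset v = mset (map p u))"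
    unfolding orbit_word_action_BijGroup[OF u] by simp
  show ?thesis
  proof
    assume ?L
    then obtain p where "bij_betw p {0, 1::nat} {0, 1}" and mv: "mset v = mset (map p u)"
      unfolding orbit by (auto simp: carrier_BijGroup)
    then have "p 0 \<in> {0, 1}" "p 1 \<in> {0, 1}" "p 0 \<noteq> p 1"
      by (auto dest: bij_betwE bij_betw_imp_inj_on inj_onD)
    then consider "p 0 = 0" "p 1 = 1" | "p 0 = 1" "p 1 = 0"
      by auto
    then show ?R
    proof cases
      case 1
      then have "map p u = u" using set_u by (intro map_idI) auto
      with mv show ?thesis by (simp add: balance_eq_mset)
    next
      case 2
      have "balance v = balance (map p u)" using mv by (simp only: balance_eq_mset)
      with balance_map_swap[OF set_u 2] show ?thesis by simp
    qed
  next
    assume ?R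
    then consider "balance v = balance u" | "balance v = - balance u" by linarith
    then show ?L
    proof cases
      case 1
      then have "mset v = mset u" using mset_eq_iff_balance_eq[OF v u] by simp
      moreover have "map (restrict id {0, 1}) u = u" using set_u by (intro map_idI) auto
      moreover have "restrict id {0, 1} \<in> carrier (BijGroup {0, 1::nat})"
        by (auto simp: carrier_BijGroup bij_betw_def inj_on_def)
      ultimately show ?thesis unfolding orbit by metis
    next
      case 2
      define s where "s = restrict (\<lambda>a. 1 - a) {0, 1::nat}"
      have s: "s 0 = 1" "s 1 = 0" "s \<in> carrier (BijGroup {0, 1})"
        by (auto simp: s_def carrier_BijGroup bij_betw_def inj_on_def)
      have "map s u \<in> words {0, 1} l"
        using u s(1,2) by (auto simp: words_def)
      moreover have "balance v = balance (map s u)"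
        using 2 balance_map_swap[OF set_u s(1,2)] by simp
      ultimately have "mset v = mset (map s u)"
        using mset_eq_iff_balance_eq[OF v] by blast
      with s(3) show ?thesis unfolding orbit by blast
    qed
  qed
qed

text \<open>
  If equivalence means equality of an invariant \<open>f\<close>, then the classes are the fibres of \<open>f\<close>.
\<close>

lemma card_quotient_invariant:
  assumes "\<And>x y. (x, y) \<in> r \<longleftrightarrow> x \<in> S \<and> y \<in> S \<and> f y = f x"
  shows "card (S // r) = card (f ` S)"
proof -
  have "S // r = (\<lambda>c. {y \<in> S. f y = c}) ` f ` S"
    by (auto simp: quotient_def assms Image_def)
  moreover have "inj_on (\<lambda>c. {y \<in> S. f y = c}) (f ` S)"
    by (rule inj_onI) blast
  ultimately show ?thesis by (simp add: card_image)
qed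

lemma binary_group_complexity:
  assumes "range w \<subseteq> {0, 1}"
  shows "group_complexity {0, 1} (BijGroup {0, 1}) (\<lambda>p. p) (BijGroup {..<l}) (\<lambda>p. p) w l
           = card ((\<lambda>u. \<bar>balance u\<bar>) ` factors w l)"
  unfolding group_complexity_def
proof (rule card_quotient_invariant)
  fix u v
  show "(u, v) \<in> factor_equiv {0, 1} (BijGroup {0, 1}) (\<lambda>p. p) (BijGroup {..<l}) (\<lambda>p. p) w l
      \<longleftrightarrow> u \<in> factors w l \<and> v \<in> factors w l \<and> \<bar>balance v\<bar> = \<bar>balance u\<bar>"
    using binary_orbit_iff factors_subset_words[OF assms, of l] by (auto simp: factor_equiv_def)
qed

section \<open>Balances of the factors of the Thue--Morse word\<close>

lemma tm_binary: "tm n = 0 \<or> tm n = 1"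
  using is_thue_morse_tm unfolding is_thue_morse_def by blast

lemma tm_step: "tm n = tm_morphism (tm (n div 2)) ! (n mod 2)"
  using is_thue_morse_tm unfolding is_thue_morse_def by (metis morphism_word_tm_morphism)

lemma tm_even: "tm (2 * n) = tm n"
  using tm_step[of "2 * n"] tm_binary[of n] by (auto simp: tm_morphism_def)

lemma tm_odd: "tm (Suc (2 * n)) = 1 - tm n"
  using tm_step[of "Suc (2 * n)"] tm_binary[of n] by (auto simp: tm_morphism_def)

text \<open>
  The argument is a descent on a hypothetical period \<open>m\<close>.  If \<open>m = 2 * k\<close>, then the even positions
  of the word, which again spell the word, show that \<open>k\<close> is a period.  If \<open>m = 2 * k + 1\<close>, then
  shifting by \<open>m\<close> sends each block across the border of two neighbouring blocks; comparing both
  halves of the block gives \<open>tm (a + k) = 1 - tm a = tm (a + k + 1)\<close>.  So the word would be constant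
  from position \<open>k\<close> on, which no sequence of blocks \<open>01\<close> and \<open>10\<close> is.
\<close>

lemma tm_not_periodic: "m > 0 \<Longrightarrow> \<exists>a. tm (a + m) \<noteq> tm a"
proof (induction m rule: less_induct)
  case (less m)
  show ?case
  proof (cases "even m")
    case True
    then obtain k where k: "m = 2 * k" by blast
    with less.prems have "0 < k" "k < m" by auto
    from less.IH[OF this(2,1)] obtain a where "tm (a + k) \<noteq> tm a" by blast
    then have "tm (2 * a + m) \<noteq> tm (2 * a)"
      using tm_even[of "a + k"] tm_even[of a] by (simp add: k)
    then show ?thesis by blast
  next
    case False
    then obtain k where k: "m = Suc (2 * k)" by (rule oddE) (rule that, simp)
    show ?thesis
    proof (rule ccontr)
      assume "\<nexists>a. tm (a + m) \<noteq> tm a"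
      then have per: "tm (a + m) = tm a" for a by blast
      have eq: "tm (a + k) = tm (Suc (a + k))" for a
      proof -
        have "1 - tm (a + k) = tm a"
          using per[of "2 * a"] tm_odd[of "a + k"] tm_even[of a] by (simp add: k)
        moreover have "tm (Suc (a + k)) = 1 - tm a"
          using per[of "Suc (2 * a)"] tm_even[of "Suc (a + k)"] tm_odd[of a] by (simp add: k)
        ultimately show ?thesis using tm_binary[of "a + k"] by auto
      qed
      \<comment> \<open>The block at position \<open>2 * k\<close> is \<open>01\<close> or \<open>10\<close>, so its two letters differ.\<close>
      from eq[of k] have "tm (2 * k) = tm (Suc (2 * k))" by (simp add: mult_2)
      then show False using tm_even[of k] tm_odd[of k] tm_binary[of k] by auto
    qed
  qed
qed

text \<open>
  The balance of a factor is the difference of the balances of two prefixes, so it suffices to know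
  the latter.
\<close>

definition excess :: "nat word \<Rightarrow> nat \<Rightarrow> int" where
  "excess w n = balance (prefix n w)"

lemma excess_0: "excess w 0 = 0"
  by (simp add: excess_def balance_def)

lemma excess_Suc: "excess w (Suc n) = excess w n + 2 * int (w n) - 1"
  by (simp add: excess_def balance_def)

lemma abs_balance_factors:
  "(\<lambda>u. \<bar>balance u\<bar>) ` factors w l = range (\<lambda>i. \<bar>excess w (i + l) - excess w i\<bar>)"
proof -
  have "excess w (i + l) = excess w i + balance (subsequence w i (i + l))" for i
    by (simp only: excess_def subsequence_append) (simp add: balance_def)
  then have "balance (subsequence w i (i + l)) = excess w (i + l) - excess w i" for i
    by simp
  then have "(\<lambda>i. \<bar>balance (subsequence w i (i + l))\<bar>) = (\<lambda>i. \<bar>excess w (i + l) - excess w i\<bar>)"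
    by simp
  moreover have "factors w l = range (\<lambda>i. subsequence w i (i + l))"
    by (auto simp: factors_def)
  ultimately show ?thesis by (simp only: image_image)
qed

lemma excess_tm_even: "excess tm (2 * n) = 0"
proof (induction n)
  case (Suc n)
  then show ?case
    using tm_binary[of n] by (auto simp: excess_Suc tm_even tm_odd)
qed (simp add: excess_0)

lemma excess_tm_odd: "excess tm (Suc (2 * n)) = 2 * int (tm n) - 1"
  by (simp add: excess_Suc excess_tm_even tm_even)

lemma abs_balance_factors_tm_odd:
  assumes "odd l"
  shows "(\<lambda>u. \<bar>balance u\<bar>) ` factors tm l = {1}"
proof -
  have even: "excess tm n = 0" if "even n" for n
    using that excess_tm_even by (auto elim!: evenE)
  have odd: "\<bar>excess tm n\<bar> = 1" if n: "odd n" for n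
  proof -
    obtain k where "n = Suc (2 * k)" using n by (rule oddE) (rule that, simp)
    then show ?thesis using tm_binary[of k] by (auto simp: excess_tm_odd)
  qed
  \<comment> \<open>Exactly one of the two ends of the factor is even.\<close>
  have "\<bar>excess tm (i + l) - excess tm i\<bar> = 1" for i
  proof (cases "even i")
    case True
    then show ?thesis using even[of i] odd[of "i + l"] assms by simp
  next
    case False
    then show ?thesis using odd[of i] even[of "i + l"] assms by simp
  qed
  then show ?thesis by (simp add: abs_balance_factors)
qed

lemma abs_balance_factors_tm_even:
  assumes "even l" "l > 0"
  shows "(\<lambda>u. \<bar>balance u\<bar>) ` factors tm l = {0, 2}"
proof -
  obtain m where l: "l = 2 * m" and m: "m > 0" using assms by auto
  let ?d = "\<lambda>i. \<bar>excess tm (i + l) - excess tm i\<bar>"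
  have even: "?d (2 * a) = 0" for a
    using excess_tm_even[of a] excess_tm_even[of "a + m"] by (simp add: l)
  have odd: "?d (Suc (2 * a)) = (if tm (a + m) = tm a then 0 else 2)" for a
    using excess_tm_odd[of a] excess_tm_odd[of "a + m"] tm_binary[of a] tm_binary[of "a + m"]
    by (auto simp: l)
  have "?d i \<in> {0, 2}" for i
  proof (cases "even i")
    case True
    then show ?thesis using even by (auto elim!: evenE)
  next
    case False
    then obtain a where "i = Suc (2 * a)" by (rule oddE) (rule that, simp)
    then show ?thesis using odd[of a] by simp
  qed
  moreover have "0 \<in> range ?d"
    by (rule range_eqI) (rule even[symmetric])
  moreover have "2 \<in> range ?d"
  proof -
    obtain a where "tm (a + m) \<noteq> tm a" using tm_not_periodic[OF m] by blast
    then have "2 = ?d (Suc (2 * a))" by (simp only: odd if_False)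
    then show ?thesis by (rule range_eqI)
  qed
  ultimately show ?thesis unfolding abs_balance_factors by blast
qed

theorem proposition3p3:
  fixes l :: nat
  assumes "l > 0"
  shows "group_complexity {0, 1} (BijGroup {0, 1}) (\<lambda>p. p) (BijGroup {..<l}) (\<lambda>p. p) tm l
           = (if odd l then 1 else 2)"
proof -
  have "range tm \<subseteq> {0, 1}" using is_thue_morse_tm by (simp add: is_thue_morse_def)
  note binary_group_complexity[OF this, of l]
  then show ?thesis
    using abs_balance_factors_tm_odd[of l] abs_balance_factors_tm_even[of l] assms by auto
qed

end
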